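(* Let $(U,V)$ be a pair of real-valued random variables with $\mathbb{P}(U>0)>0$, $\mathbb{P}(V>0)>0$, $\mathbb{E}[U]<0$ and $\mathbb{E}[V]<0$. Let $(U_1,V_1),(U_2,V_2),\ldots$ be i.i.d. copies of $(U,V)$, and for $k\ge 1$ put $$T^1_k:=\sup_{k\le i<\infty}\left(U_k+\cdots+U_i\right),\qquad T^2_k:=\sup_{k\le i<j<\infty}\left(V_k+\cdots+V_i+U_{i+1}+\cdots+U_j\right).$$ (a) The integral equation (for all $(u,v)\in\overline{\mathbb{R}}^2$) $$\mathbb{E}\left[\mathbf{1}_{\{u\ge U\}}\,\psi\big((u-U)\wedge(v-V),\,v-V\big)\right]=\psi(u,v)$$ admits a unique solution in the class of bounded functions $\psi$ on $\overline{\mathbb{R}}^2$ having the limit $\psi(\infty,\infty)=\lim_{u,v\to\infty}\psi(u,v)=1$. This solution is $\psi(u,v):=\mathbb{P}(T^1_1\le u,\ T^2_1\le v)$. (b) Let $\gamma:\overline{\mathbb{R}}^2\to(-\infty,K_\gamma]$, for some finite $K_\gamma$, satisfy for all $(u,v)\in\operatorname{supp}(\gamma\vee 0)$ $$\mathbb{E}\left[\mathbf{1}_{\{u\ge U\}}\,\gamma\big((u-U)\wedge(v-V),\,v-V\big)\right]\ge\gamma(u,v).$$ If $\gamma(\infty,\infty):=\limsup_{u,v\to\infty}\gamma(u,v)=1$, then $\psi\ge\gamma$ on $\overline{\mathbb{R}}^2$, where $\psi$ is the function from (a). (c) Let $\eta:\overline{\mathbb{R}}^2\to[0,\infty)$ satisfy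 for all $(u,v)\in\operatorname{supp}(\psi)$ with $v\ge u$ $$\mathbb{E}\left[\mathbf{1}_{\{u\ge U\}}\,\eta\big((u-U)\wedge(v-V),\,v-V\big)\right]\le\eta(u,v),$$ where $\psi$ is the function from (a). If $\eta(\infty,\infty):=\liminf_{u,v\to\infty}\eta(u,v)=1$, then $\psi(u,v)\le\eta(u,v)$ for all $(u,v)\in\overline{\mathbb{R}}^2$ with $v\ge u$.
   Context: Notation: $\overline{\mathbb{R}}:=\mathbb{R}\cup\{\pm\infty\}$ with its usual topology and $\pm\infty-x=\pm\infty$ for real $x$; $u\wedge v:=\min\{u,v\}$, $u\vee v:=\max\{u,v\}$. For a function $\phi$, $\operatorname{supp}(\phi):=\{x:\phi(x)\ne 0\}$ and $\operatorname{supp}(\phi\vee 0):=\{x:\phi(x)>0\}$ (no closure is taken). All functions are Borel measurable. Limits $\lim$, $\limsup$, $\liminf$ as $u,v\to\infty$ are taken over $(u,v)\in\overline{\mathbb{R}}^2$, $(u,v)\to(\infty,\infty)$; notations such as "$\gamma(\infty,\infty):=\limsup\gamma$" mean that the value at $(\infty,\infty)$ equals that limit. The expectations $\mathbb{E}[U],\mathbb{E}[V]$ are allowed to equal $-\infty$ (positive parts integrable). In the application, $U=Y-X$, $V=Z-X$ with $X$ an inter-arrival time and $Y,Z$ service times of a two-queue tandem. *)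

theory Defs
  imports "HOL-Probability.Probability"
begin

text \<open>
  Expectation of a real random variable as an extended real number, namely
  the expectation of the positive part minus that of the negative part
  (\<^term>\<open>ennreal\<close> truncates negative arguments to \<open>0\<close>).  Unlike the Bochner integral,
  it takes the values \<open>-\<infinity>\<close> and \<open>\<infinity>\<close> rather than defaulting to \<open>0\<close> if exactly one of
  the two parts has infinite expectation.  It is meaningful only if at least one part
  has finite expectation.
\<close>

definition ext_expectation :: "'a measure \<Rightarrow> ('a \<Rightarrow> real) \<Rightarrow> ereal" where
  "ext_expectation M X =
     enn2ereal (\<integral>\<^sup>+\<omega>. ennreal (X \<omega>) \<partial>M) - enn2ereal (\<integral>\<^sup>+\<omega>. ennreal (- X \<omega>) \<partial>M)"

lemma ext_expectation_eq_integral: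
  assumes "integrable M X"
  shows "ext_expectation M X = ereal (integral\<^sup>L M X)"
proof -
  have "(\<integral>\<^sup>+\<omega>. ennreal (X \<omega>) \<partial>M) \<noteq> \<infinity>" "(\<integral>\<^sup>+\<omega>. ennreal (- X \<omega>) \<partial>M) \<noteq> \<infinity>"
    using assms by (auto simp: real_integrable_def)
  then obtain a b where "0 \<le> a" "0 \<le> b"
      "(\<integral>\<^sup>+\<omega>. ennreal (X \<omega>) \<partial>M) = ennreal a" "(\<integral>\<^sup>+\<omega>. ennreal (- X \<omega>) \<partial>M) = ennreal b"
    by (metis ennreal_cases infinity_ennreal_def)
  then show ?thesis
    using assms by (simp add: ext_expectation_def real_lebesgue_integral_def enn2ereal_ennreal)
qed

lemma ext_expectation_nonneg:
  assumes "\<And>\<omega>. 0 \<le> X \<omega>"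
  shows "ext_expectation M X = enn2ereal (\<integral>\<^sup>+\<omega>. ennreal (X \<omega>) \<partial>M)"
  using assms by (simp add: ext_expectation_def ennreal_neg zero_ennreal.rep_eq)

definition supp :: "('a \<Rightarrow> real) \<Rightarrow> 'a set" where
  "supp f = {x. f x \<noteq> 0}"

definition step_expectation ::
  "'a measure \<Rightarrow> ('a \<Rightarrow> real) \<Rightarrow> ('a \<Rightarrow> real) \<Rightarrow> (ereal \<times> ereal \<Rightarrow> real) \<Rightarrow> ereal \<Rightarrow> ereal \<Rightarrow> ereal" where
  "step_expectation M U V \<phi> u v =
     ext_expectation M (\<lambda>\<omega>. indicator {\<omega>. ereal (U \<omega>) \<le> u} \<omega> *
       \<phi> (min (u - ereal (U \<omega>)) (v - ereal (V \<omega>)), v - ereal (V \<omega>)))"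

definition T1 :: "(nat \<Rightarrow> 'a \<Rightarrow> real) \<Rightarrow> nat \<Rightarrow> 'a \<Rightarrow> ereal" where
  "T1 Us k \<omega> = (SUP i\<in>{k..}. ereal (\<Sum>n=k..i. Us n \<omega>))"

definition T2 :: "(nat \<Rightarrow> 'a \<Rightarrow> real) \<Rightarrow> (nat \<Rightarrow> 'a \<Rightarrow> real) \<Rightarrow> nat \<Rightarrow> 'a \<Rightarrow> ereal" where
  "T2 Us Vs k \<omega> =
     (SUP (i, j)\<in>{(i, j). k \<le> i \<and> i < j}. ereal ((\<Sum>n=k..i. Vs n \<omega>) + (\<Sum>n=Suc i..j. Us n \<omega>)))"

definition joint_cdf ::
  "'a measure \<Rightarrow> (nat \<Rightarrow> 'a \<Rightarrow> real) \<Rightarrow> (nat \<Rightarrow> 'a \<Rightarrow> real) \<Rightarrow> ereal \<times> ereal \<Rightarrow> real" where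
  "joint_cdf M Us Vs =
     (\<lambda>(u, v). measure M {\<omega> \<in> space M. T1 Us 1 \<omega> \<le> u \<and> T2 Us Vs 1 \<omega> \<le> v})"

text \<open>
  Bounded Borel solutions of the integral equation that converge to \<open>1\<close> at \<open>(\<infinity>, \<infinity>)\<close>.
  The filter \<^term>\<open>at (\<infinity>, \<infinity>)\<close> omits the point \<open>(\<infinity>, \<infinity>)\<close> itself, but contains points having
  one infinite coordinate; the value at \<open>(\<infinity>, \<infinity>)\<close> is therefore prescribed separately.
\<close>

definition is_solution ::
  "'a measure \<Rightarrow> ('a \<Rightarrow> real) \<Rightarrow> ('a \<Rightarrow> real) \<Rightarrow> (ereal \<times> ereal \<Rightarrow> real) \<Rightarrow> bool" where
  "is_solution M U V \<phi> \<longleftrightarrow>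
     \<phi> \<in> borel_measurable borel \<and> bounded (range \<phi>) \<and>
     (\<phi> \<longlongrightarrow> 1) (at (\<infinity>, \<infinity>)) \<and> \<phi> (\<infinity>, \<infinity>) = 1 \<and>
     (\<forall>u v. step_expectation M U V \<phi> u v = ereal (\<phi> (u, v)))"

end

theory Submission
  imports Defs
begin

text \<open>
  Read the increments as a stream \<open>s\<close> of pairs \<open>(U\<^sub>k, V\<^sub>k)\<close>, starting with \<open>k = 0\<close>, and let a
  point of the extended plane move by \<open>(u, v) \<mapsto> (min (u - U) (v - V), v - V)\<close>; it is killed at
  the first step with \<open>U > u\<close>.  The integral operator of the theorem is the transition operator
  of this killed Markov chain.  Solving the recursion for the first coordinate shows that the chain
  started at \<open>(u, v)\<close> is never killed iff \<open>T\<^sup>1\<^sub>1 \<le> u\<close> and \<open>T\<^sup>2\<^sub>1 \<le> v\<close> (\<open>survives_iff\<close>,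
  \<open>T1_T2_le_iff_survives\<close>), so the joint distribution function \<open>\<psi>\<close> is the survival probability.
  Conditioning on the first step makes it a solution.

  Because both drifts are negative, almost every path that survives tends to \<open>(\<infinity>, \<infinity>)\<close>
  (\<open>AE_stable_path\<close>, \<open>state_tendsto_infinity\<close>).  Iterating \<open>\<gamma> \<le> E \<gamma>(next state)\<close> gives
  \<open>\<gamma>(u, v) \<le> E [\<gamma>(state after n steps); alive]\<close>.  In the limit, the integrand is at most \<open>1\<close> on
  survival and \<open>0\<close> otherwise, and the reverse Fatou lemma yields \<open>\<gamma> \<le> \<psi>\<close>.  The Fatou lemma treats
  \<open>\<eta>\<close> in the same way.  There \<open>\<eta>\<close> has to be replaced by \<open>0\<close> off the support of \<open>\<psi>\<close>, since
  its inequality is known on the support only; this changes nothing in the limit,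
  because \<open>\<psi>\<close> tends to \<open>1\<close>.  The constraint \<open>u \<le> v\<close> persists along the chain, because a
  minimum with the new second coordinate is taken in each step.

  Uniqueness follows from the bound for subsolutions alone.  If \<open>\<phi>\<close> is a bounded solution with
  limit \<open>1\<close>, then so is \<open>2\<psi> - \<phi>\<close>, by linearity.  Both lie below \<open>\<psi>\<close>, hence \<open>\<phi> = \<psi>\<close>.

  The drift statement needs that a random walk with negative mean is bounded above almost surely.
  It is proved by Loynes' argument (\<open>AE_partial_sums_bdd_above\<close>).  It is
  applied to two auxiliary walks, obtained from truncations of \<open>U\<close> and \<open>V\<close>.
\<close>

section \<open>Random walks with negative drift are bounded above\<close>

lemma (in prob_space) distr_Stream:
  "distr (M \<Otimes>\<^sub>M stream_space M) (stream_space M) (\<lambda>(x, s). x ## s) = stream_space M"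
proof (rule measure_eqI)
  interpret S: prob_space "stream_space M" by (rule prob_space_stream_space)
  fix X assume "X \<in> sets (distr (M \<Otimes>\<^sub>M stream_space M) (stream_space M) (\<lambda>(x, s). x ## s))"
  then have X[measurable]: "X \<in> sets (stream_space M)" by simp
  have "emeasure (distr (M \<Otimes>\<^sub>M stream_space M) (stream_space M) (\<lambda>(x, s). x ## s)) X
      = (\<integral>\<^sup>+z. indicator X (case z of (x, s) \<Rightarrow> x ## s) \<partial>(M \<Otimes>\<^sub>M stream_space M))"
    using X by (subst nn_integral_indicator[symmetric], simp, subst nn_integral_distr) simp_all
  also have "\<dots> = (\<integral>\<^sup>+x. \<integral>\<^sup>+s. indicator X (x ## s) \<partial>stream_space M \<partial>M)"
    by (subst S.nn_integral_fst[symmetric]) auto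
  also have "\<dots> = emeasure (stream_space M) X"
    by (subst nn_integral_stream_space[symmetric]) auto
  finally show "emeasure (distr (M \<Otimes>\<^sub>M stream_space M) (stream_space M) (\<lambda>(x, s). x ## s)) X
      = emeasure (stream_space M) X" .
qed simp

text \<open>
  Equal to \<open>Max {S\<^sub>k | k \<le> n}\<close> for the partial sums \<open>S\<^sub>k\<close> of \<open>f\<close> along the stream, including
  \<open>S\<^sub>0 = 0\<close>.  Recursion at the head of the stream expresses \<open>M\<^sub>n\<^sub>+\<^sub>1\<close> through \<open>M\<^sub>n\<close> of the shifted
  stream, which is independent of the head and distributed like the whole stream.
\<close>

primrec running_max :: "('a \<Rightarrow> real) \<Rightarrow> nat \<Rightarrow> 'a stream \<Rightarrow> real" where
  "running_max f 0 s = 0"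
| "running_max f (Suc n) s = max 0 (f (shd s) + running_max f n (stl s))"

lemma running_max_nonneg: "0 \<le> running_max f n s"
  by (cases n) auto

lemma running_max_Suc_ge: "running_max f n s \<le> running_max f (Suc n) s"
proof (induction n arbitrary: s)
  case (Suc n)
  show ?case using Suc[of "stl s"] by simp
qed simp

lemma partial_sum_le_running_max: "(\<Sum>k<n. f (s !! k)) \<le> running_max f n s"
proof (induction n arbitrary: s)
  case (Suc n)
  show ?case using Suc[of "stl s"] by (simp add: sum.lessThan_Suc_shift del: sum.lessThan_Suc)
qed simp

lemma measurable_running_max[measurable]:
  assumes [measurable]: "f \<in> borel_measurable M"
  shows "running_max f n \<in> borel_measurable (stream_space M)"
  by (induction n) simp_all

definition unbounded_walk :: "('a \<Rightarrow> real) \<Rightarrow> 'a stream \<Rightarrow> bool" where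
  "unbounded_walk f s \<longleftrightarrow> (\<forall>m::nat. \<exists>n. real m < running_max f n s)"

text \<open>
  One increment changes every partial sum by the same finite amount.  Shift invariance makes
  the event independent of the head of the stream and lets expectations be restricted to it.
\<close>

lemma unbounded_walk_Stream: "unbounded_walk f (x ## s) \<longleftrightarrow> unbounded_walk f s"
proof
  assume L: "unbounded_walk f (x ## s)"
  show "unbounded_walk f s" unfolding unbounded_walk_def
  proof
    fix m :: nat
    obtain m' :: nat where m': "real m + \<bar>f x\<bar> < real m'" using reals_Archimedean2 by blast
    obtain n where n: "real m' < running_max f n (x ## s)"
      using L unfolding unbounded_walk_def by blast
    then obtain k where "n = Suc k" by (cases n) auto
    then have "real m < running_max f k s" using n m' by auto
    then show "\<exists>n. real m < running_max f n s" by blast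
  qed
next
  assume R: "unbounded_walk f s"
  show "unbounded_walk f (x ## s)" unfolding unbounded_walk_def
  proof
    fix m :: nat
    obtain m' :: nat where m': "real m + \<bar>f x\<bar> < real m'" using reals_Archimedean2 by blast
    obtain n where n: "real m' < running_max f n s"
      using R unfolding unbounded_walk_def by blast
    have "real m < running_max f (Suc n) (x ## s)" using n m' by auto
    then show "\<exists>n. real m < running_max f n (x ## s)" by blast
  qed
qed

lemma running_max_tendsto_infinity:
  assumes "unbounded_walk f s"
  shows "\<forall>\<^sub>F n in sequentially. y < running_max f n s"
proof -
  obtain m :: nat where m: "y < real m" using reals_Archimedean2 by blast
  obtain n where n: "real m < running_max f n s"
    using assms unfolding unbounded_walk_def by blast
  have "y < running_max f k s" if "n \<le> k" for k
    using lift_Suc_mono_le[of "\<lambda>n. running_max f n s", OF running_max_Suc_ge that] m n by linarith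
  then show ?thesis unfolding eventually_sequentially by blast
qed

text \<open>
  Loynes' argument.  Let \<open>A\<close> be the event that the running maxima \<open>M\<^sub>n\<close> are unbounded, \<open>x\<close> the head
  of the stream and \<open>M\<^sub>n'\<close> the maximum of the shifted stream.  Then
  \<open>M\<^sub>n\<^sub>+\<^sub>1 - M\<^sub>n' = max (- M\<^sub>n') (f x)\<close>.  On \<open>A\<close>, this has expectation \<open>E [M\<^sub>n\<^sub>+\<^sub>1; A] - E [M\<^sub>n; A] \<ge> 0\<close>
  by stationarity and invariance of \<open>A\<close>.  Since \<open>M\<^sub>n'\<close> tends to infinity on \<open>A\<close>, dominated
  convergence gives \<open>0 \<le> E [f x; A] = P A * E f\<close>, so \<open>A\<close> is a null set.
\<close>

lemma (in prob_space) AE_partial_sums_bdd_above: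
  fixes f :: "'a \<Rightarrow> real"
  assumes f: "integrable M f" and neg: "integral\<^sup>L M f < 0"
  shows "AE s in stream_space M. \<exists>C. \<forall>n. (\<Sum>k<n. f (s !! k)) \<le> C"
proof -
  let ?S = "stream_space M"
  let ?P = "M \<Otimes>\<^sub>M ?S"
  interpret S: prob_space ?S by (rule prob_space_stream_space)
  interpret P: pair_prob_space M ?S ..
  have [measurable]: "f \<in> borel_measurable M" using f by auto
  have [measurable]: "Measurable.pred ?S (unbounded_walk f)" unfolding unbounded_walk_def by measurable
  define a :: "'a stream \<Rightarrow> real" where "a s = of_bool (unbounded_walk f s)" for s
  have [measurable]: "a \<in> borel_measurable ?S" unfolding a_def by measurable

  have intf: "integrable ?P (\<lambda>z. f (fst z))"
    using f by (intro P.Fubini_integrable) (auto simp: S.prob_space)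
  have lift: "integrable ?P (\<lambda>z. g (snd z))" "(\<integral>z. g (snd z) \<partial>?P) = integral\<^sup>L ?S g"
    if g: "integrable ?S g" for g :: "'a stream \<Rightarrow> real"
  proof -
    have [measurable]: "g \<in> borel_measurable ?S" using g by auto
    show i: "integrable ?P (\<lambda>z. g (snd z))"
      using g by (intro P.Fubini_integrable) (auto simp: prob_space)
    show "(\<integral>z. g (snd z) \<partial>?P) = integral\<^sup>L ?S g"
      by (subst P.integral_fst'[OF i, symmetric]) (simp add: prob_space)
  qed
  have intR: "integrable ?S (running_max f n)" for n
  proof (induction n)
    case (Suc n)
    have "integrable ?P (\<lambda>z. max 0 (f (fst z) + running_max f n (snd z)))"
      using intf lift(1)[OF Suc] by auto
    then have "integrable ?P (\<lambda>z. running_max f (Suc n) (case z of (x, s) \<Rightarrow> x ## s))"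
      by (simp add: case_prod_beta)
    then have "integrable (distr ?P ?S (\<lambda>(x, s). x ## s)) (running_max f (Suc n))"
      by (subst integrable_distr_eq) auto
    then show ?case by (simp only: distr_Stream)
  qed simp
  have a_Stream: "a (x ## s) = a s" for x s by (simp add: a_def unbounded_walk_Stream)
  have intaR: "integrable ?S (\<lambda>s. a s * running_max f n s)" for n
    by (rule Bochner_Integration.integrable_bound[OF intR[of n]]) (auto simp: a_def)
  \<comment> \<open>Split off the head of the stream; the pair space ?P carries the head and the shifted stream.\<close>
  have step: "integral\<^sup>L ?S (\<lambda>s. a s * running_max f (Suc n) s)
      = (\<integral>z. a (snd z) * max 0 (f (fst z) + running_max f n (snd z)) \<partial>?P)"
    and int_step: "integrable ?P (\<lambda>z. a (snd z) * max 0 (f (fst z) + running_max f n (snd z)))" for n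
  proof -
    have "integral\<^sup>L ?S (\<lambda>s. a s * running_max f (Suc n) s)
      = integral\<^sup>L (distr ?P ?S (\<lambda>(x, s). x ## s)) (\<lambda>s. a s * running_max f (Suc n) s)"
      by (simp only: distr_Stream)
    also have "\<dots> = (\<integral>z. a (snd z) * max 0 (f (fst z) + running_max f n (snd z)) \<partial>?P)"
      by (subst integral_distr) (auto simp: case_prod_beta a_Stream)
    finally show "integral\<^sup>L ?S (\<lambda>s. a s * running_max f (Suc n) s)
      = (\<integral>z. a (snd z) * max 0 (f (fst z) + running_max f n (snd z)) \<partial>?P)" .
    show "integrable ?P (\<lambda>z. a (snd z) * max 0 (f (fst z) + running_max f n (snd z)))"
      by (rule Bochner_Integration.integrable_bound[OF Bochner_Integration.integrable_add[OF
            integrable_abs[OF intf] lift(1)[OF intR[of n]]]])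
        (auto simp: a_def running_max_nonneg)
  qed
  have "(\<integral>z. a (snd z) * max (- running_max f n (snd z)) (f (fst z)) \<partial>?P)
      = integral\<^sup>L ?S (\<lambda>s. a s * running_max f (Suc n) s) - integral\<^sup>L ?S (\<lambda>s. a s * running_max f n s)" for n
    unfolding step lift(2)[OF intaR, symmetric]
      Bochner_Integration.integral_diff[OF int_step lift(1)[OF intaR], symmetric]
    by (intro Bochner_Integration.integral_cong) (auto simp: max_def algebra_simps)
  moreover have "integral\<^sup>L ?S (\<lambda>s. a s * running_max f n s) \<le> integral\<^sup>L ?S (\<lambda>s. a s * running_max f (Suc n) s)" for n
    by (rule integral_mono[OF intaR intaR])
      (auto intro!: mult_left_mono running_max_Suc_ge simp: a_def simp del: running_max.simps)
  ultimately have nonneg: "0 \<le> (\<integral>z. a (snd z) * max (- running_max f n (snd z)) (f (fst z)) \<partial>?P)" for n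
    by simp
  have "(\<lambda>n. \<integral>z. a (snd z) * max (- running_max f n (snd z)) (f (fst z)) \<partial>?P)
      \<longlonglongrightarrow> (\<integral>z. a (snd z) * f (fst z) \<partial>?P)"
  proof (rule integral_dominated_convergence[where w="\<lambda>z. \<bar>f (fst z)\<bar>"])
    show "AE z in ?P. (\<lambda>n. a (snd z) * max (- running_max f n (snd z)) (f (fst z)))
        \<longlonglongrightarrow> a (snd z) * f (fst z)"
    proof (rule AE_I2)
      fix z
      show "(\<lambda>n. a (snd z) * max (- running_max f n (snd z)) (f (fst z))) \<longlonglongrightarrow> a (snd z) * f (fst z)"
      proof (cases "unbounded_walk f (snd z)")
        case True
        from running_max_tendsto_infinity[OF this, of "- f (fst z)"]
        have "\<forall>\<^sub>F n in sequentially. a (snd z) * max (- running_max f n (snd z)) (f (fst z)) = a (snd z) * f (fst z)"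
          by eventually_elim (auto simp: max_def)
        then show ?thesis by (rule tendsto_eventually)
      qed (simp add: a_def)
    qed
    show "AE z in ?P. norm (a (snd z) * max (- running_max f n (snd z)) (f (fst z))) \<le> \<bar>f (fst z)\<bar>" for n
      using running_max_nonneg[of f n] by (intro AE_I2) (auto simp: a_def max_def)
  qed (use intf in auto)
  then have "0 \<le> (\<integral>z. a (snd z) * f (fst z) \<partial>?P)"
    using nonneg by (intro LIMSEQ_le_const) auto
  also have "(\<integral>z. a (snd z) * f (fst z) \<partial>?P) = (\<integral>x. \<integral>s. a s * f x \<partial>?S \<partial>M)"
    using P.integral_fst'[of "\<lambda>z. a (snd z) * f (fst z)"]
      Bochner_Integration.integrable_bound[OF intf, of "\<lambda>z. a (snd z) * f (fst z)"]
    by (auto simp: a_def)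
  also have "\<dots> = integral\<^sup>L ?S a * integral\<^sup>L M f" by simp
  finally have "integral\<^sup>L ?S a \<le> 0" using neg by (simp add: zero_le_mult_iff)
  moreover have inta: "integrable ?S a" by (rule S.integrable_const_bound[where B=1]) (auto simp: a_def)
  moreover have "0 \<le> integral\<^sup>L ?S a" by (rule integral_nonneg_AE) (auto simp: a_def)
  ultimately have "AE s in ?S. a s = 0"
    using integral_nonneg_eq_0_iff_AE[OF inta] by (auto simp: a_def)
  then show ?thesis
  proof eventually_elim
    case (elim s)
    then obtain m :: nat where "\<forall>n. running_max f n s \<le> real m"
      by (auto simp: a_def unbounded_walk_def not_less split: if_splits)
    then show ?case using partial_sum_le_running_max order_trans by blast
  qed
qed

text \<open>
  Truncation from below reduces a mean of \<open>-\<infinity>\<close> to a finite one: by monotone convergence, the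
  truncated negative part already outweighs the positive part for large \<open>K\<close>.  The truncated
  variable dominates \<open>X\<close>, so upper bounds for its random walk carry over.
\<close>

lemma truncated_mean_negative:
  fixes X :: "'a \<Rightarrow> real"
  assumes M: "prob_space M" and X[measurable]: "X \<in> borel_measurable M"
    and pos: "integrable M (\<lambda>x. max (X x) 0)" and neg: "ext_expectation M X < 0"
  obtains K :: nat where "integrable M (\<lambda>x. max (X x) (- real K))"
    "(\<integral>x. max (X x) (- real K) \<partial>M) < 0"
proof -
  interpret prob_space M by fact
  have pos_eq: "(\<integral>\<^sup>+x. ennreal (X x) \<partial>M) = ennreal (\<integral>x. max (X x) 0 \<partial>M)"
    using nn_integral_eq_integral[OF pos] by (simp add: ennreal_max_0 max.commute)
  have "(\<integral>\<^sup>+x. ennreal (X x) \<partial>M) < (\<integral>\<^sup>+x. ennreal (- X x) \<partial>M)"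
  proof (rule ccontr)
    assume "\<not> ?thesis"
    then have "(\<integral>\<^sup>+x. ennreal (- X x) \<partial>M) \<le> (\<integral>\<^sup>+x. ennreal (X x) \<partial>M)" by simp
    moreover then have "enn2ereal (\<integral>\<^sup>+x. ennreal (- X x) \<partial>M) \<noteq> \<infinity>"
      using pos_eq by (metis enn2ereal_ennreal ennreal_less_top enn2ereal_eq_top_iff infinity_ennreal_def less_le top.not_eq_extremum top.extremum_unique)
    ultimately have "0 \<le> ext_expectation M X"
      unfolding ext_expectation_def
      by (subst ereal_diff_positive) (auto simp: less_eq_ennreal.rep_eq)
    then show False using neg by simp
  qed
  also have "(\<lambda>x. ennreal (- X x)) = (\<lambda>x. SUP K. ennreal (min (- X x) (real K)))"
  proof
    fix x
    show "ennreal (- X x) = (SUP K. ennreal (min (- X x) (real K)))"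
    proof (rule antisym)
      obtain K :: nat where "- X x < real K" using reals_Archimedean2 by blast
      then show "ennreal (- X x) \<le> (SUP K. ennreal (min (- X x) (real K)))"
        by (intro SUP_upper2[of K]) auto
    qed (auto intro!: SUP_least ennreal_leI)
  qed
  also have "(\<integral>\<^sup>+x. (SUP K. ennreal (min (- X x) (real K))) \<partial>M) = (SUP K. \<integral>\<^sup>+x. ennreal (min (- X x) (real K)) \<partial>M)"
    by (rule nn_integral_monotone_convergence_SUP) (auto simp: incseq_def le_fun_def intro!: ennreal_leI)
  finally obtain K :: nat where K: "(\<integral>\<^sup>+x. ennreal (X x) \<partial>M) < (\<integral>\<^sup>+x. ennreal (min (- X x) (real K)) \<partial>M)"
    by (auto simp: less_SUP_iff)
  have i: "integrable M (\<lambda>x. max 0 (min (- X x) (real K)))"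
    by (rule integrable_const_bound[where B="real K"]) auto
  have "(\<integral>\<^sup>+x. ennreal (min (- X x) (real K)) \<partial>M) = ennreal (\<integral>x. max 0 (min (- X x) (real K)) \<partial>M)"
    using nn_integral_eq_integral[OF i] by (simp add: ennreal_max_0)
  with K have lt: "(\<integral>x. max (X x) 0 \<partial>M) < (\<integral>x. max 0 (min (- X x) (real K)) \<partial>M)"
    unfolding pos_eq by (simp add: ennreal_less_iff integral_nonneg_AE)
  have eq: "max (X x) (- real K) = max (X x) 0 - max 0 (min (- X x) (real K))" for x
    by (auto simp: max_def min_def)
  show thesis
    using lt by (intro that[of K]; unfold eq) (auto intro: pos i simp: Bochner_Integration.integral_diff[OF pos i])
qed

section \<open>The killed chain along a fixed path\<close>

definition tandem_step :: "ereal \<times> ereal \<Rightarrow> real \<times> real \<Rightarrow> ereal \<times> ereal" where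
  "tandem_step p x = (min (fst p - ereal (fst x)) (snd p - ereal (snd x)), snd p - ereal (snd x))"

definition state :: "nat \<Rightarrow> ereal \<times> ereal \<Rightarrow> (real \<times> real) stream \<Rightarrow> ereal \<times> ereal" where
  "state n p s = foldl tandem_step p (stake n s)"

definition survives :: "ereal \<times> ereal \<Rightarrow> (real \<times> real) stream \<Rightarrow> bool" where
  "survives p s \<longleftrightarrow> (\<forall>n. ereal (fst (s !! n)) \<le> fst (state n p s))"

definition U_sum :: "nat \<Rightarrow> (real \<times> real) stream \<Rightarrow> real" where
  "U_sum n s = (\<Sum>k<n. fst (s !! k))"

definition V_sum :: "nat \<Rightarrow> (real \<times> real) stream \<Rightarrow> real" where
  "V_sum n s = (\<Sum>k<n. snd (s !! k))"

lemma U_sum_simps[simp]: "U_sum 0 s = 0" "U_sum (Suc n) s = U_sum n s + fst (s !! n)"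
  by (simp_all add: U_sum_def)

lemma V_sum_simps[simp]: "V_sum 0 s = 0" "V_sum (Suc n) s = V_sum n s + snd (s !! n)"
  by (simp_all add: V_sum_def)

lemma state_0[simp]: "state 0 p s = p"
  by (simp add: state_def)

text \<open>
  The chain can be unrolled at either end.  The last step serves to compute the coordinates along a
  fixed path, the first step to integrate over the head of a random stream.
\<close>

lemma state_Suc: "state (Suc n) p s = tandem_step (state n p s) (s !! n)"
  by (simp add: state_def stake_Suc del: stake.simps)

lemma state_Suc_Stream: "state (Suc n) p (x ## s) = state n (tandem_step p x) s"
  by (simp add: state_def)

lemma survives_Stream:
  "survives p (x ## s) \<longleftrightarrow> ereal (fst x) \<le> fst p \<and> survives (tandem_step p x) s"
proof -
  have "(\<forall>n. Q n) \<longleftrightarrow> Q 0 \<and> (\<forall>n. Q (Suc n))" for Q :: "nat \<Rightarrow> bool"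
    by (metis not0_implies_Suc)
  from this[of "\<lambda>n. ereal (fst ((x ## s) !! n)) \<le> fst (state n p (x ## s))"]
  show ?thesis by (simp add: survives_def state_Suc_Stream)
qed

lemma snd_state: "snd (state n p s) = snd p - ereal (V_sum n s)"
proof (induction n)
  case (Suc n)
  then show ?case by (cases "snd p") (simp_all add: state_Suc tandem_step_def)
qed (simp add: zero_ereal_def[symmetric])

lemma ereal_le_minus_real: "ereal x \<le> y - ereal z \<longleftrightarrow> ereal (x + z) \<le> y"
  by (cases y) auto

text \<open>
  The first coordinate after \<open>n\<close> steps is the minimum of \<open>u - (U\<^sub>0 + \<dots> + U\<^sub>n\<^sub>-\<^sub>1)\<close> and of the values
  \<open>v - (V\<^sub>0 + \<dots> + V\<^sub>i\<^sub>-\<^sub>1) - (U\<^sub>i + \<dots> + U\<^sub>n\<^sub>-\<^sub>1)\<close> for \<open>1 \<le> i \<le> n\<close>: the second coordinate takes over the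
  minimum for the last time at step \<open>i\<close>.  Lower bounds by real numbers avoid infinite values in the
  sums.
\<close>

lemma le_fst_state_iff:
  "ereal x \<le> fst (state n p s) \<longleftrightarrow>
     ereal (x + U_sum n s) \<le> fst p \<and>
     (\<forall>i\<in>{1..n}. ereal (x + V_sum i s + (U_sum n s - U_sum i s)) \<le> snd p)"
proof (induction n arbitrary: x)
  case (Suc n)
  have eq: "x + fst (s !! n) + V_sum i s + (U_sum n s - U_sum i s) = x + V_sum i s + (U_sum (Suc n) s - U_sum i s)" for i
    by simp
  have last: "(\<forall>i\<in>{1..Suc n}. P i) \<longleftrightarrow> (\<forall>i\<in>{1..n}. P i) \<and> P (Suc n)" for P
    using atLeastAtMostSuc_conv[of 1 n] by auto
  have "ereal x \<le> fst (state (Suc n) p s) \<longleftrightarrow>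
      ereal (x + fst (s !! n)) \<le> fst (state n p s) \<and> ereal (x + V_sum (Suc n) s) \<le> snd p"
    by (simp add: state_Suc tandem_step_def snd_state ereal_le_minus_real add_ac)
  also have "\<dots> \<longleftrightarrow> ereal (x + U_sum (Suc n) s) \<le> fst p \<and>
     (\<forall>i\<in>{1..Suc n}. ereal (x + V_sum i s + (U_sum (Suc n) s - U_sum i s)) \<le> snd p)"
    unfolding Suc eq last by (simp add: add.assoc add.commute[of "fst _"])
  finally show ?case .
qed simp

lemma survives_iff:
  "survives p s \<longleftrightarrow> (\<forall>n. ereal (U_sum (Suc n) s) \<le> fst p) \<and>
     (\<forall>n. \<forall>i\<in>{1..n}. ereal (V_sum i s + (U_sum (Suc n) s - U_sum i s)) \<le> snd p)"
  unfolding survives_def le_fst_state_iff by (simp add: algebra_simps) blast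

text \<open>
  A start with \<open>u = -\<infinity>\<close> is killed at the first step.  A start with \<open>v = -\<infinity>\<close> has first coordinate
  \<open>-\<infinity>\<close> after one step and is killed at the second.
\<close>

lemma survives_finite:
  assumes "survives p s"
  shows "\<exists>r. ereal r \<le> fst p \<and> ereal r \<le> snd p"
proof -
  have 1: "ereal (U_sum 1 s) \<le> fst p"
    using assms[unfolded survives_iff, THEN conjunct1, rule_format, of 0] by simp
  have 2: "ereal (V_sum 1 s + (U_sum 2 s - U_sum 1 s)) \<le> snd p"
    using assms[unfolded survives_iff, THEN conjunct2, rule_format, of 1 1] by (simp add: numeral_2_eq_2)
  show ?thesis
    by (rule exI[of _ "min (U_sum 1 s) (V_sum 1 s + (U_sum 2 s - U_sum 1 s))"])
      (metis 1 2 ereal_less_eq(3) min.cobounded1 min.cobounded2 order_trans)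
qed

lemma survives_mono:
  assumes "survives p s" "fst p \<le> fst q" "snd p \<le> snd q"
  shows "survives q s"
  using assms unfolding survives_iff by (meson order_trans)

section \<open>Surviving paths escape to infinity\<close>

text \<open>
  The expression bounded here is the sum of the first \<open>i\<close> values of \<open>V\<close> and the values of \<open>U\<close> with
  indices from \<open>i\<close> to \<open>n - 1\<close>.  The case \<open>i = 0\<close> bounds the walk of \<open>U\<close>, and \<open>i = n\<close> that of \<open>V\<close>, so one
  condition controls both coordinates of the chain.
\<close>

definition stable_path :: "(real \<times> real) stream \<Rightarrow> bool" where
  "stable_path s \<longleftrightarrow>
     (\<exists>e>0. \<exists>C. \<forall>n. \<forall>i\<le>n. V_sum i s + (U_sum n s - U_sum i s) \<le> C - e * real n)"

lemma state_tendsto_infinity: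
  assumes s: "stable_path s" and p: "ereal r \<le> fst p" "ereal r \<le> snd p"
  shows "(\<lambda>n. state n p s) \<longlonglongrightarrow> (\<infinity>, \<infinity>)"
proof -
  obtain e C where e: "e > 0" and C: "\<And>n i. i \<le> n \<Longrightarrow> V_sum i s + (U_sum n s - U_sum i s) \<le> C - e * real n"
    using s unfolding stable_path_def by blast
  have big: "\<forall>\<^sub>F n in sequentially. ereal y \<le> fst (state n p s) \<and> ereal y \<le> snd (state n p s)" for y
  proof -
    obtain N :: nat where N: "(y + C - r) / e < real N" using reals_Archimedean2 by blast
    have "ereal y \<le> fst (state n p s) \<and> ereal y \<le> snd (state n p s)" if "n \<ge> N" for n
    proof -
      have "(y + C - r) / e \<le> real n" using N that by linarith
      then have "y + C - r \<le> e * real n" using e by (simp add: field_simps)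
      then have *: "y + (V_sum i s + (U_sum n s - U_sum i s)) \<le> r" if "i \<le> n" for i
        using C[OF that] by linarith
      have "ereal (y + U_sum n s) \<le> fst p"
        using *[of 0] p(1) by (intro order_trans[OF _ p(1)]) simp
      moreover have V: "ereal (y + V_sum i s + (U_sum n s - U_sum i s)) \<le> snd p" if "i \<le> n" for i
        using *[OF that] by (intro order_trans[OF _ p(2)]) simp
      ultimately show ?thesis
        using V[of n] by (auto simp: le_fst_state_iff snd_state ereal_le_minus_real)
    qed
    then show ?thesis unfolding eventually_sequentially by blast
  qed
  have big': "\<forall>\<^sub>F n in sequentially. ereal y < fst (state n p s) \<and> ereal y < snd (state n p s)" for y
    using big[of "y + 1"]
    by eventually_elim (meson ereal_less(2) le_less_trans less_add_one less_ereal.simps(1) less_le_trans)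
  have "(\<lambda>n. (fst (state n p s), snd (state n p s))) \<longlonglongrightarrow> (\<infinity>, \<infinity>)"
    using big' by (intro tendsto_Pair; unfold tendsto_PInfty) (force elim: eventually_mono)+
  then show ?thesis by simp
qed

text \<open>
  All sums that have to stay below \<open>u\<close> or \<open>v\<close> are bounded along a stable path.  Hence almost every
  path survives from far enough out, which gives the limit \<open>1\<close> of the survival probability.
\<close>

lemma stable_path_survives:
  assumes "stable_path s"
  obtains N :: nat where "\<And>p. ereal (real N) \<le> fst p \<Longrightarrow> ereal (real N) \<le> snd p \<Longrightarrow> survives p s"
proof -
  obtain e C where e: "e > 0" and C: "\<And>n i. i \<le> n \<Longrightarrow> V_sum i s + (U_sum n s - U_sum i s) \<le> C - e * real n"
    using assms unfolding stable_path_def by blast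
  obtain N :: nat where N: "C < real N" using reals_Archimedean2 by blast
  have *: "V_sum i s + (U_sum n s - U_sum i s) \<le> real N" if "i \<le> n" for i n
  proof -
    have "0 \<le> e * real n" using e by simp
    then show ?thesis using C[OF that] N by linarith
  qed
  have "survives p s" if "ereal (real N) \<le> fst p" "ereal (real N) \<le> snd p" for p
    unfolding survives_iff
  proof (intro conjI allI ballI)
    fix n
    show "ereal (U_sum (Suc n) s) \<le> fst p"
      using *[of 0 "Suc n"] by (intro order_trans[OF _ that(1)]) simp
    fix i assume "i \<in> {1..n}"
    then show "ereal (V_sum i s + (U_sum (Suc n) s - U_sum i s)) \<le> snd p"
      using *[of i "Suc n"] by (intro order_trans[OF _ that(2)]) simp
  qed
  then show thesis by (rule that)
qed

lemma measurable_fst_snd_borel[measurable]: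
  "fst \<in> borel_measurable (borel :: ('a::topological_space \<times> 'b::topological_space) measure)"
  "snd \<in> borel_measurable (borel :: ('a::topological_space \<times> 'b::topological_space) measure)"
  by (auto intro!: borel_measurable_continuous_onI continuous_intros)

locale increment_law = prob_space D for D :: "(real \<times> real) measure" +
  assumes sets_D[measurable_cong, simp]: "sets D = sets borel"
begin

lemma borel_measurable_fst[measurable]: "fst \<in> borel_measurable D"
  and borel_measurable_snd[measurable]: "snd \<in> borel_measurable D"
  unfolding measurable_cong_sets[OF sets_D refl] by (rule measurable_fst_snd_borel)+

end

locale negative_drift = increment_law D for D :: "(real \<times> real) measure" +
  assumes pos_U: "integrable D (\<lambda>x. max (fst x) 0)" and pos_V: "integrable D (\<lambda>x. max (snd x) 0)"
    and neg_U: "ext_expectation D fst < 0" and neg_V: "ext_expectation D snd < 0"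

lemma U_sum_diff: "i \<le> n \<Longrightarrow> U_sum n s - U_sum i s = (\<Sum>k=i..<n. fst (s !! k))"
  unfolding U_sum_def by (induction n rule: dec_induct) auto

text \<open>
  Let \<open>f\<close> and \<open>g\<close> be truncations of \<open>U\<close> and \<open>V\<close> with means \<open>a < 0\<close> and \<open>b < 0\<close>.  There are
  \<open>c\<close> and \<open>d\<close> with \<open>max 0 (b - a) < d < c < - a\<close>, so that \<open>f + c\<close> and \<open>g - f - d\<close> have negative mean and
  their walks are bounded above.  The mixed sum is the walk of \<open>f\<close> up to \<open>n\<close> plus the walk of \<open>g - f\<close>
  up to \<open>i\<close>, so it is at most a constant plus \<open>d * i - c * n\<close>.  As \<open>0 \<le> d\<close> and \<open>i \<le> n\<close>, it decreases at
  rate \<open>c - d\<close>.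
\<close>

lemma (in negative_drift) AE_stable_path: "AE s in stream_space D. stable_path s"
proof -
  obtain K where iU: "integrable D (\<lambda>x. max (fst x) (- real K))"
    and nU: "(\<integral>x. max (fst x) (- real K) \<partial>D) < 0"
    using truncated_mean_negative[OF prob_space_axioms _ pos_U neg_U] by (metis borel_measurable_fst)
  obtain L where iV: "integrable D (\<lambda>x. max (snd x) (- real L))"
    and nV: "(\<integral>x. max (snd x) (- real L) \<partial>D) < 0"
    using truncated_mean_negative[OF prob_space_axioms _ pos_V neg_V] by (metis borel_measurable_snd)
  define f g where "f x = max (fst x) (- real K)" and "g x = max (snd x) (- real L)" for x :: "real \<times> real"
  note iU = iU[folded f_def] and iV = iV[folded g_def]
  obtain d where d: "max 0 (integral\<^sup>L D g - integral\<^sup>L D f) < d" "d < - integral\<^sup>L D f"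
    using nU nV dense[of "max 0 (integral\<^sup>L D g - integral\<^sup>L D f)" "- integral\<^sup>L D f"]
    by (fastforce simp: f_def[symmetric] g_def[symmetric])
  obtain c where c: "d < c" "c < - integral\<^sup>L D f" using d(2) dense by blast
  have "AE s in stream_space D. \<exists>C. \<forall>n. (\<Sum>k<n. f (s !! k) + c) \<le> C"
    by (rule AE_partial_sums_bdd_above) (use iU c in \<open>auto simp: prob_space\<close>)
  moreover have "AE s in stream_space D. \<exists>C. \<forall>n. (\<Sum>k<n. g (s !! k) - f (s !! k) - d) \<le> C"
    by (rule AE_partial_sums_bdd_above) (use iU iV d in \<open>auto simp: prob_space\<close>)
  ultimately show ?thesis
  proof eventually_elim
    case (elim s)
    then obtain A B where A: "\<And>n. (\<Sum>k<n. f (s !! k) + c) \<le> A"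
      and B: "\<And>n. (\<Sum>k<n. g (s !! k) - f (s !! k) - d) \<le> B" by blast
    have "V_sum i s + (U_sum n s - U_sum i s) \<le> (A + B) - (c - d) * real n" if "i \<le> n" for i n
    proof -
      have "V_sum i s + (U_sum n s - U_sum i s) \<le> (\<Sum>k<i. g (s !! k)) + (\<Sum>k=i..<n. f (s !! k))"
        unfolding U_sum_diff[OF that] V_sum_def by (intro add_mono sum_mono) (auto simp: f_def g_def)
      also have "\<dots> = (\<Sum>k<i. g (s !! k) - f (s !! k) - d) + (\<Sum>k<n. f (s !! k) + c) + d * real i - c * real n"
        using that by (induction n rule: dec_induct) (auto simp: sum.distrib sum_subtractf algebra_simps)
      also have "\<dots> \<le> B + A + d * real n - c * real n"
      proof -
        have "d * real i \<le> d * real n" using d(1) that by (intro mult_left_mono) auto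
        then show ?thesis using A[of n] B[of i] by linarith
      qed
      finally show ?thesis by (simp add: algebra_simps)
    qed
    then show ?case unfolding stable_path_def using c(1) by (intro exI[of _ "c - d"]) auto
  qed
qed

section \<open>Iterating the transition operator\<close>

text \<open>
  The \<open>n\<close>-step analogue of the integrand of the integral equation: \<open>g\<close> at the state after \<open>n\<close> steps,
  or \<open>0\<close> if the chain has been killed before.
\<close>

definition killed :: "(ereal \<times> ereal \<Rightarrow> ennreal) \<Rightarrow> nat \<Rightarrow> ereal \<times> ereal \<Rightarrow> (real \<times> real) stream \<Rightarrow> ennreal" where
  "killed g n p s =
     (if \<forall>k<n. ereal (fst (s !! k)) \<le> fst (state k p s) then g (state n p s) else 0)"

lemma killed_0[simp]: "killed g 0 p = (\<lambda>s. g p)"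
  by (simp add: killed_def fun_eq_iff)

lemma killed_Suc_Stream:
  "killed g (Suc n) p (x ## s) = (if ereal (fst x) \<le> fst p then killed g n (tandem_step p x) s else 0)"
proof -
  have "(\<forall>k<Suc n. Q k) \<longleftrightarrow> Q 0 \<and> (\<forall>k<n. Q (Suc k))" for Q :: "nat \<Rightarrow> bool"
    by (metis not0_implies_Suc Suc_less_eq zero_less_Suc)
  from this[of "\<lambda>k. ereal (fst ((x ## s) !! k)) \<le> fst (state k p (x ## s))"]
  have alive: "(\<forall>k<Suc n. ereal (fst ((x ## s) !! k)) \<le> fst (state k p (x ## s))) \<longleftrightarrow>
      ereal (fst x) \<le> fst p \<and> (\<forall>k<n. ereal (fst (s !! k)) \<le> fst (state k (tandem_step p x) s))"
    by (simp add: state_Suc_Stream)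
  show ?thesis unfolding killed_def alive state_Suc_Stream by auto
qed

text \<open>
  The operator of the integral equation with values in the extended nonnegative reals, where it
  can be iterated without integrability conditions.
\<close>

definition transition :: "(real \<times> real) measure \<Rightarrow> (ereal \<times> ereal \<Rightarrow> ennreal) \<Rightarrow> ereal \<times> ereal \<Rightarrow> ennreal" where
  "transition D g p =
     (\<integral>\<^sup>+x. (if ereal (fst x) \<le> fst p then g (tandem_step p x) else 0) \<partial>D)"

lemma transition_mono: "(\<And>q. g q \<le> h q) \<Longrightarrow> transition D g p \<le> transition D h p"
  unfolding transition_def by (intro nn_integral_mono) auto

definition survival_prob :: "(real \<times> real) measure \<Rightarrow> ereal \<times> ereal \<Rightarrow> real" where
  "survival_prob D p = measure (stream_space D) {s \<in> space (stream_space D). survives p s}"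

context increment_law
begin

sublocale S: prob_space "stream_space D"
  by (rule prob_space_stream_space)

lemma measurable_tandem_step[measurable]:
  "(\<lambda>x. tandem_step p x) \<in> D \<rightarrow>\<^sub>M borel"
  unfolding tandem_step_def by measurable

lemma measurable_state[measurable]:
  "(\<lambda>z. state n (fst z) (snd z)) \<in> borel \<Otimes>\<^sub>M stream_space D \<rightarrow>\<^sub>M borel"
proof -
  have "(\<lambda>z. fst (state n (fst z) (snd z))) \<in> borel_measurable (borel \<Otimes>\<^sub>M stream_space D) \<and>
      (\<lambda>z. snd (state n (fst z) (snd z))) \<in> borel_measurable (borel \<Otimes>\<^sub>M stream_space D)"
  proof (induction n)
    case (Suc n)
    then have [measurable]: "(\<lambda>z. fst (state n (fst z) (snd z))) \<in> borel_measurable (borel \<Otimes>\<^sub>M stream_space D)"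
      "(\<lambda>z. snd (state n (fst z) (snd z))) \<in> borel_measurable (borel \<Otimes>\<^sub>M stream_space D)"
      by blast+
    show ?case unfolding state_Suc tandem_step_def fst_conv snd_conv by measurable
  qed auto
  then have "(\<lambda>z. (fst (state n (fst z) (snd z)), snd (state n (fst z) (snd z))))
      \<in> borel_measurable (borel \<Otimes>\<^sub>M stream_space D)"
    by (intro borel_measurable_Pair) auto
  then show ?thesis by simp
qed

lemma measurable_killed[measurable]:
  assumes [measurable]: "g \<in> borel_measurable borel"
  shows "(\<lambda>z. killed g n (fst z) (snd z)) \<in> borel_measurable (borel \<Otimes>\<^sub>M stream_space D)"
  unfolding killed_def by measurable

lemma measurable_killed'[measurable]:
  assumes "g \<in> borel_measurable borel"
  shows "(\<lambda>s. killed g n p s) \<in> borel_measurable (stream_space D)"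
  using measurable_compose[OF measurable_Pair1' measurable_killed[OF assms]] by simp

lemma measurable_survives[measurable]:
  "Measurable.pred (borel \<Otimes>\<^sub>M stream_space D) (\<lambda>z. survives (fst z) (snd z))"
  unfolding survives_def by measurable

lemma measurable_survives'[measurable]: "Measurable.pred (stream_space D) (survives p)"
  using measurable_compose[OF measurable_Pair1' measurable_survives, of p] by simp

lemma nn_integral_killed_Suc:
  assumes [measurable]: "g \<in> borel_measurable borel"
  shows "(\<integral>\<^sup>+s. killed g (Suc n) p s \<partial>stream_space D)
    = transition D (\<lambda>q. \<integral>\<^sup>+s. killed g n q s \<partial>stream_space D) p"
  unfolding transition_def
  by (subst nn_integral_stream_space) (auto simp: killed_Suc_Stream intro!: nn_integral_cong)

lemma subsolution_le_killed:
  assumes g: "g \<in> borel_measurable borel" and le: "\<And>p. g p \<le> transition D g p"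
  shows "g p \<le> (\<integral>\<^sup>+s. killed g n p s \<partial>stream_space D)"
proof (induction n arbitrary: p)
  case (Suc n)
  have "g p \<le> transition D g p" by (rule le)
  also have "\<dots> \<le> (\<integral>\<^sup>+s. killed g (Suc n) p s \<partial>stream_space D)"
    unfolding nn_integral_killed_Suc[OF g] by (intro transition_mono Suc)
  finally show ?case .
qed (simp add: S.emeasure_space_1)

text \<open>
  Every step leads into the half plane \<open>u \<le> v\<close>, so the induction never leaves it.
\<close>

lemma killed_le_supersolution:
  assumes g: "g \<in> borel_measurable borel"
    and le: "\<And>p. fst p \<le> snd p \<Longrightarrow> transition D g p \<le> g p" and p: "fst p \<le> snd p"
  shows "(\<integral>\<^sup>+s. killed g n p s \<partial>stream_space D) \<le> g p"
  using p
proof (induction n arbitrary: p)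
  case (Suc n)
  have "(\<integral>\<^sup>+s. killed g (Suc n) p s \<partial>stream_space D) \<le> transition D g p"
    unfolding nn_integral_killed_Suc[OF g] transition_def
    by (intro nn_integral_mono) (auto intro!: Suc.IH simp: tandem_step_def)
  also have "\<dots> \<le> g p" using le Suc by blast
  finally show ?case .
qed (simp add: S.emeasure_space_1)

lemma ennreal_survival_prob:
  "ennreal (survival_prob D p) = (\<integral>\<^sup>+s. of_bool (survives p s) \<partial>stream_space D)"
proof -
  have "(\<integral>\<^sup>+s. of_bool (survives p s) \<partial>stream_space D)
      = (\<integral>\<^sup>+s. indicator {s \<in> space (stream_space D). survives p s} s \<partial>stream_space D)"
    by (intro nn_integral_cong) (auto split: split_indicator)
  also have "\<dots> = ennreal (survival_prob D p)"
    unfolding survival_prob_def S.emeasure_eq_measure[symmetric] by (rule nn_integral_indicator) measurable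
  finally show ?thesis by simp
qed

lemma survival_prob_le_1: "survival_prob D p \<le> 1"
  by (simp add: survival_prob_def)

lemma survival_prob_nonneg: "0 \<le> survival_prob D p"
  by (simp add: survival_prob_def)

lemma measurable_survival_prob[measurable]: "survival_prob D \<in> borel_measurable borel"
proof -
  have "(\<lambda>p. ennreal (survival_prob D p)) \<in> borel_measurable borel"
    unfolding ennreal_survival_prob
    by (rule S.borel_measurable_nn_integral) (simp add: case_prod_beta)
  then have "(\<lambda>p. enn2real (ennreal (survival_prob D p))) \<in> borel_measurable borel"
    by measurable
  then show ?thesis by (simp add: survival_prob_nonneg)
qed

lemma transition_survival_prob:
  "transition D (\<lambda>q. ennreal (survival_prob D q)) p = ennreal (survival_prob D p)"
  unfolding ennreal_survival_prob transition_def
  by (subst (2) nn_integral_stream_space) (auto simp: survives_Stream intro!: nn_integral_cong)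

end

section \<open>Comparison with the survival probability\<close>

lemma eventually_nhds_infinity:
  "\<forall>\<^sub>F p in nhds (\<infinity> :: ereal, \<infinity> :: ereal). ereal r \<le> fst p \<and> ereal r \<le> snd p"
proof -
  have "open ({ereal r<..} \<times> {ereal r<..})" by (intro open_Times) auto
  then have "\<forall>\<^sub>F p in nhds (\<infinity>, \<infinity>). p \<in> {ereal r<..} \<times> {ereal r<..}"
    by (rule eventually_nhds_in_open) simp
  then show ?thesis by eventually_elim (auto simp: mem_Times_iff)
qed

context negative_drift
begin

text \<open>
  The survival probability is monotone in both coordinates.  Along the diagonal points \<open>(N, N)\<close>, the
  survival events increase to an event of full measure.
\<close>

lemma eventually_survival_prob:
  assumes "e > 0"
  shows "\<forall>\<^sub>F p in nhds (\<infinity>, \<infinity>). 1 - e \<le> survival_prob D p"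
proof -
  define B where "B N = {s \<in> space (stream_space D). survives (ereal (real N), ereal (real N)) s}" for N
  have [measurable]: "B N \<in> sets (stream_space D)" for N unfolding B_def by measurable
  have "(\<lambda>N. S.prob (B N)) \<longlonglongrightarrow> S.prob (\<Union>N. B N)"
  proof (rule S.finite_Lim_measure_incseq)
    show "incseq B" by (auto simp: incseq_def B_def elim!: survives_mono)
  qed auto
  also have "S.prob (\<Union>N. B N) = 1"
  proof -
    have "AE s in stream_space D. s \<in> (\<Union>N. B N)"
      using AE_stable_path AE_space
    proof eventually_elim
      case (elim s)
      obtain N :: nat where "\<And>p. ereal (real N) \<le> fst p \<Longrightarrow> ereal (real N) \<le> snd p \<Longrightarrow> survives p s"
        using stable_path_survives[OF elim(1)] by blast
      from this[of "(ereal (real N), ereal (real N))"] show ?case using elim(2) by (auto simp: B_def)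
    qed
    then show ?thesis by (subst S.prob_eq_1) auto
  qed
  finally obtain N where N: "1 - e < S.prob (B N)"
    using order_tendstoD(1)[of _ 1 sequentially "1 - e"] assms
    by (auto simp: eventually_sequentially)
  show ?thesis using eventually_nhds_infinity[of "real N"]
  proof eventually_elim
    case (elim p)
    have "S.prob (B N) \<le> survival_prob D p" unfolding survival_prob_def B_def
      by (intro S.finite_measure_mono) (auto elim: survives_mono simp: elim)
    then show ?case using N by simp
  qed
qed

lemma survives_state_tendsto:
  assumes "stable_path s" "survives p s"
  shows "filterlim (\<lambda>n. state n p s) (nhds (\<infinity>, \<infinity>)) sequentially"
  using assms survives_finite state_tendsto_infinity by blast

text \<open>
  The bound \<open>K\<close> permits the reverse Fatou lemma for the iterated inequality.  Passing to extended
  nonnegative reals replaces \<open>\<gamma>\<close> by its positive part, which satisfies the subsolution inequality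
  at every point.
\<close>

lemma subsolution_le_survival_prob:
  assumes [measurable]: "\<gamma> \<in> borel_measurable borel" and K: "\<And>p. \<gamma> p \<le> K"
    and sub: "\<And>p. 0 < \<gamma> p \<Longrightarrow> ennreal (\<gamma> p) \<le> transition D (\<lambda>q. ennreal (\<gamma> q)) p"
    and lim: "\<And>e. e > 0 \<Longrightarrow> \<forall>\<^sub>F p in nhds (\<infinity>, \<infinity>). \<gamma> p \<le> 1 + e"
  shows "\<gamma> p \<le> survival_prob D p"
proof -
  let ?g = "\<lambda>q. ennreal (\<gamma> q)" and ?S = "stream_space D"
  have sub': "?g q \<le> transition D ?g q" for q
    using sub[of q] by (cases "0 < \<gamma> q") (auto simp: ennreal_neg)
  have "?g p \<le> limsup (\<lambda>n. \<integral>\<^sup>+s. killed ?g n p s \<partial>?S)"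
    using subsolution_le_killed[OF _ sub'] by (intro le_Limsup) auto
  also have "\<dots> \<le> (\<integral>\<^sup>+s. limsup (\<lambda>n. killed ?g n p s) \<partial>?S)"
  proof (rule nn_integral_limsup)
    show "AE s in ?S. killed ?g n p s \<le> ennreal K" for n
    proof (rule AE_I2)
      show "killed ?g n p s \<le> ennreal K" for s
        using ennreal_leI[OF K[of "state n p s"]] by (simp add: killed_def)
    qed
  qed (auto simp: S.emeasure_space_1 ennreal_mult_less_top)
  also have "\<dots> \<le> (\<integral>\<^sup>+s. of_bool (survives p s) \<partial>?S)"
  proof (rule nn_integral_mono_AE, use AE_stable_path in eventually_elim)
    fix s assume s: "stable_path s"
    show "limsup (\<lambda>n. killed ?g n p s) \<le> of_bool (survives p s)"
    proof (cases "survives p s")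
      case True
      \<comment> \<open>The surviving chain tends to infinity, where the subsolution is eventually at most 1 + e.\<close>
      have bound: "limsup (\<lambda>n. killed ?g n p s) \<le> 1 + ennreal e" if "e > 0" for e
      proof (rule Limsup_bounded)
        show "\<forall>\<^sub>F n in sequentially. killed ?g n p s \<le> 1 + ennreal e"
          using filterlim_iff[THEN iffD1, OF survives_state_tendsto[OF s True], rule_format, OF lim[OF that]]
        proof eventually_elim
          case (elim n)
          then have "ennreal (\<gamma> (state n p s)) \<le> ennreal (1 + e)" by (rule ennreal_leI)
          then show ?case using that by (simp add: killed_def)
        qed
      qed
      have "limsup (\<lambda>n. killed ?g n p s) \<le> 1"
        by (rule ennreal_le_epsilon, rule bound)
      then show ?thesis using True by simp
    next
      case False
      then obtain k where k: "\<not> ereal (fst (s !! k)) \<le> fst (state k p s)"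
        unfolding survives_def by blast
      have "\<forall>\<^sub>F n in sequentially. killed ?g n p s \<le> 0"
        using eventually_gt_at_top[of k] by eventually_elim (use k in \<open>auto simp: killed_def\<close>)
      then have "limsup (\<lambda>n. killed ?g n p s) \<le> 0" by (rule Limsup_bounded)
      then show ?thesis using False by simp
    qed
  qed
  also have "\<dots> = ennreal (survival_prob D p)" by (rule ennreal_survival_prob[symmetric])
  finally show ?thesis by (simp add: ennreal_le_iff survival_prob_nonneg)
qed

text \<open>
  Setting \<open>\<eta>\<close> to \<open>0\<close> where the survival probability \<open>\<psi>\<close> vanishes gives a function \<open>h\<close> that satisfies
  the supersolution inequality at every point with \<open>u \<le> v\<close>: from a zero of \<open>\<psi>\<close>, the chain
  almost surely is killed or moves to a zero of \<open>\<psi>\<close>.  Near infinity \<open>\<psi>\<close> is positive, so \<open>h\<close> and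
  \<open>\<eta>\<close> agree there and the Fatou lemma applies to \<open>h\<close>.
\<close>

lemma survival_prob_le_supersolution:
  assumes [measurable]: "\<eta> \<in> borel_measurable borel" and nonneg: "\<And>p. 0 \<le> \<eta> p"
    and super: "\<And>p. survival_prob D p \<noteq> 0 \<Longrightarrow> fst p \<le> snd p \<Longrightarrow>
      transition D (\<lambda>q. ennreal (\<eta> q)) p \<le> ennreal (\<eta> p)"
    and lim: "\<And>e. e > 0 \<Longrightarrow> \<forall>\<^sub>F p in nhds (\<infinity>, \<infinity>). 1 - e \<le> \<eta> p"
    and p: "fst p \<le> snd p"
  shows "survival_prob D p \<le> \<eta> p"
proof -
  let ?S = "stream_space D"
  define h where "h q = (if survival_prob D q = 0 then 0 else ennreal (\<eta> q))" for q
  have h_meas[measurable]: "h \<in> borel_measurable borel" unfolding h_def by measurable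
  have h_le: "h q \<le> ennreal (\<eta> q)" for q by (simp add: h_def)
  have zero: "ennreal (survival_prob D q) = 0 \<longleftrightarrow> survival_prob D q = 0" for q
    using survival_prob_nonneg[of q] by (auto simp: ennreal_eq_0_iff)
  have super': "transition D h q \<le> h q" if q: "fst q \<le> snd q" for q
  proof (cases "survival_prob D q = 0")
    case True
    have "transition D (\<lambda>q. ennreal (survival_prob D q)) q = 0"
      unfolding transition_survival_prob True by simp
    then have "AE x in D. (if ereal (fst x) \<le> fst q then ennreal (survival_prob D (tandem_step q x)) else 0) = 0"
      unfolding transition_def by (subst (asm) nn_integral_0_iff_AE) auto
    then have "AE x in D. (if ereal (fst x) \<le> fst q then h (tandem_step q x) else 0) = 0"
      by eventually_elim (simp add: h_def zero split: if_splits)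
    then have "transition D h q = 0"
      unfolding transition_def by (subst nn_integral_0_iff_AE) auto
    then show ?thesis by simp
  next
    case False
    have "transition D h q \<le> transition D (\<lambda>q. ennreal (\<eta> q)) q" by (intro transition_mono h_le)
    also have "\<dots> \<le> h q" using super[OF False q] False by (simp add: h_def)
    finally show ?thesis .
  qed
  have "ennreal (survival_prob D p) = (\<integral>\<^sup>+s. of_bool (survives p s) \<partial>?S)"
    by (rule ennreal_survival_prob)
  also have "\<dots> \<le> (\<integral>\<^sup>+s. liminf (\<lambda>n. killed h n p s) \<partial>?S)"
  proof (rule nn_integral_mono_AE, use AE_stable_path in eventually_elim)
    fix s assume s: "stable_path s"
    show "of_bool (survives p s) \<le> liminf (\<lambda>n. killed h n p s)"
    proof (cases "survives p s")
      case True
      have bound: "1 \<le> liminf (\<lambda>n. killed h n p s) + ennreal e" if "e > 0" for e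
      proof -
        have "ennreal (1 - e) \<le> liminf (\<lambda>n. killed h n p s)"
        proof (rule Liminf_bounded)
          \<comment> \<open>The second bound only serves to keep the survival probability away from zero.\<close>
          have "\<forall>\<^sub>F q in nhds (\<infinity>, \<infinity>). 1 - e \<le> \<eta> q \<and> 1 - 1/2 \<le> survival_prob D q"
            using lim[OF that] eventually_survival_prob[of "1/2"] by (auto intro: eventually_conj)
          from filterlim_iff[THEN iffD1, OF survives_state_tendsto[OF s True], rule_format, OF this]
          show "\<forall>\<^sub>F n in sequentially. ennreal (1 - e) \<le> killed h n p s"
          proof eventually_elim
            case (elim n)
            then have "killed h n p s = ennreal (\<eta> (state n p s))"
              using True by (auto simp: killed_def h_def survives_def)
            then show ?case using elim by (auto intro: ennreal_leI)
          qed
        qed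
        then have "ennreal (1 - e) + ennreal e \<le> liminf (\<lambda>n. killed h n p s) + ennreal e"
          by (rule add_right_mono)
        moreover have "1 \<le> ennreal (1 - e) + ennreal e"
        proof -
          have "1 \<le> ennreal (max 0 (1 - e) + e)" using ennreal_leI[of 1 "max 0 (1 - e) + e"] by simp
          also have "\<dots> = ennreal (1 - e) + ennreal e" using ennreal_plus[of "max 0 (1 - e)" e] that by (simp only: ennreal_max_0)
          finally show ?thesis .
        qed
        ultimately show ?thesis by (rule order_trans[rotated])
      qed
      have "1 \<le> liminf (\<lambda>n. killed h n p s)"
        by (rule ennreal_le_epsilon, rule bound)
      then show ?thesis using True by simp
    qed simp
  qed
  also have "\<dots> \<le> liminf (\<lambda>n. \<integral>\<^sup>+s. killed h n p s \<partial>?S)"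
    by (rule nn_integral_liminf) simp
  also have "\<dots> \<le> h p"
    using killed_le_supersolution[OF h_meas super' p] by (intro Liminf_le) auto
  also have "\<dots> \<le> ennreal (\<eta> p)" by (rule h_le)
  finally show ?thesis using nonneg by (simp add: ennreal_le_iff)
qed

end

section \<open>The law of an independent and identically distributed stream\<close>

lemma (in prob_space) indep_sets_reindex:
  assumes inj: "inj_on f J" and indep: "indep_sets F (f ` J)"
  shows "indep_sets (\<lambda>j. F (f j)) J"
proof (rule indep_setsI)
  show "F (f j) \<subseteq> events" if "j \<in> J" for j
    using indep that by (auto simp: indep_sets_def)
next
  fix A K assume K: "K \<noteq> {}" "K \<subseteq> J" "finite K" and A: "\<forall>j\<in>K. A j \<in> F (f j)"
  have inv: "inv_into J f (f j) = j" if "j \<in> K" for j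
    using inj K(2) that by (auto intro: inv_into_f_f)
  have "prob (\<Inter>i\<in>f ` K. A (inv_into J f i)) = (\<Prod>i\<in>f ` K. prob (A (inv_into J f i)))"
    using K A inv by (intro indep_setsD[OF indep]) auto
  then show "prob (\<Inter>j\<in>K. A j) = (\<Prod>j\<in>K. prob (A j))"
    using inv by (simp add: prod.reindex[OF inj_on_subset[OF inj K(2)]])
qed

lemma (in prob_space) indep_vars_reindex_Suc:
  assumes "indep_vars (\<lambda>_. N) X {1..}"
  shows "indep_vars (\<lambda>_. N) (\<lambda>k. X (Suc k)) UNIV"
proof -
  have eq: "{1..} = Suc ` UNIV" by (auto simp: image_iff) (metis Suc_le_D)
  show ?thesis
    using assms indep_sets_reindex[of Suc UNIV "\<lambda>i. {X i -` A \<inter> space M |A. A \<in> sets N}"]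
    unfolding indep_vars_def2 eq by auto
qed

text \<open>
  This transports the problem from the given random variables to the stream space, whose
  measure has the recursion at the head that the iteration uses.
\<close>

lemma (in prob_space) distr_iid_to_stream:
  assumes indep: "indep_vars (\<lambda>_. N) X UNIV"
    and distr: "\<And>k. distr M N (X k) = D" and sets: "sets D = sets N"
  shows "distr M (stream_space D) (\<lambda>\<omega>. to_stream (\<lambda>k. X k \<omega>)) = stream_space D"
proof -
  have X[measurable]: "X k \<in> measurable M N" for k
    using indep by (auto simp: indep_vars_def)
  note sets[measurable_cong]
  have PiM: "distr M (\<Pi>\<^sub>M i\<in>UNIV. N) (\<lambda>\<omega>. \<lambda>k\<in>UNIV. X k \<omega>) = (\<Pi>\<^sub>M i\<in>UNIV. D)"
    using indep_vars_iff_distr_eq_PiM[of UNIV X "\<lambda>_. N"] indep by (simp add: distr)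
  have "stream_space D = distr (\<Pi>\<^sub>M i\<in>UNIV. D) (stream_space D) to_stream"
    by (rule stream_space_eq_distr)
  also have "\<dots> = distr (distr M (\<Pi>\<^sub>M i\<in>UNIV. N) (\<lambda>\<omega>. \<lambda>k\<in>UNIV. X k \<omega>)) (stream_space D) to_stream"
    unfolding PiM ..
  also have "\<dots> = distr M (stream_space D) (to_stream \<circ> (\<lambda>\<omega>. \<lambda>k\<in>UNIV. X k \<omega>))"
  proof (rule distr_distr)
    show "to_stream \<in> (\<Pi>\<^sub>M i\<in>UNIV. N) \<rightarrow>\<^sub>M stream_space D"
      by (rule measurable_stream_space2) (simp add: to_stream_def measurable_cong_sets[OF refl sets])
    show "(\<lambda>\<omega>. \<lambda>k\<in>UNIV. X k \<omega>) \<in> M \<rightarrow>\<^sub>M (\<Pi>\<^sub>M i\<in>UNIV. N)"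
      by (rule measurable_restrict) (rule X)
  qed
  finally show ?thesis by (simp add: comp_def restrict_UNIV)
qed

section \<open>The joint distribution function as survival probability\<close>

text \<open>
  The sums of \<open>survives_iff\<close> run over the same index ranges as the suprema \<open>T\<^sup>1\<^sub>1\<close> and \<open>T\<^sup>2\<^sub>1\<close>.  The
  random variables are indexed from \<open>1\<close> and streams from \<open>0\<close>.
\<close>

lemma T1_T2_le_iff_survives:
  "T1 Us 1 \<omega> \<le> u \<and> T2 Us Vs 1 \<omega> \<le> v \<longleftrightarrow>
     survives (u, v) (to_stream (\<lambda>k. (Us (Suc k) \<omega>, Vs (Suc k) \<omega>)))"
proof -
  let ?s = "to_stream (\<lambda>k. (Us (Suc k) \<omega>, Vs (Suc k) \<omega>))"
  have nth: "?s !! k = (Us (Suc k) \<omega>, Vs (Suc k) \<omega>)" for k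
    by (simp add: to_stream_def)
  have U: "(\<Sum>n=1..i. Us n \<omega>) = U_sum i ?s" for i
    by (simp add: U_sum_def nth sum.atLeast1_atMost_eq)
  have V: "(\<Sum>n=1..i. Vs n \<omega>) = V_sum i ?s" for i
    by (simp add: V_sum_def nth sum.atLeast1_atMost_eq)
  have UU: "(\<Sum>n=Suc i..j. Us n \<omega>) = U_sum j ?s - U_sum i ?s" if "i < j" for i j
    using that sum.shift_bounds_Suc_ivl[of "\<lambda>n. Us n \<omega>" i j]
    by (simp add: U_sum_diff nth atLeastLessThanSuc_atLeastAtMost)
  have shift1: "(\<forall>i\<ge>1. P i) \<longleftrightarrow> (\<forall>n. P (Suc n))" for P :: "nat \<Rightarrow> bool"
    by (auto simp: Suc_le_eq gr0_conv_Suc)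
  have shift2: "(\<forall>i j. 1 \<le> i \<and> i < j \<longrightarrow> P i j) \<longleftrightarrow> (\<forall>n. \<forall>i\<in>{1..n}. P i (Suc n))"
    for P :: "nat \<Rightarrow> nat \<Rightarrow> bool"
  proof (intro iffI allI impI ballI)
    fix i j :: nat assume P: "\<forall>n. \<forall>i\<in>{1..n}. P i (Suc n)" and ij: "1 \<le> i \<and> i < j"
    then show "P i j" using P[rule_format, of i "j - 1"] by (cases j) auto
  qed auto
  have "T1 Us 1 \<omega> \<le> u \<longleftrightarrow> (\<forall>i\<ge>1. ereal (U_sum i ?s) \<le> u)"
    unfolding T1_def SUP_le_iff U by auto
  also have "\<dots> \<longleftrightarrow> (\<forall>n. ereal (U_sum (Suc n) ?s) \<le> u)"
    by (rule shift1)
  finally have T1: "T1 Us 1 \<omega> \<le> u \<longleftrightarrow> (\<forall>n. ereal (U_sum (Suc n) ?s) \<le> u)" .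
  have "T2 Us Vs 1 \<omega> \<le> v \<longleftrightarrow> (\<forall>i j. 1 \<le> i \<and> i < j \<longrightarrow> ereal (V_sum i ?s + (U_sum j ?s - U_sum i ?s)) \<le> v)"
    unfolding T2_def SUP_le_iff V by (auto simp: UU)
  also have "\<dots> \<longleftrightarrow> (\<forall>n. \<forall>i\<in>{1..n}. ereal (V_sum i ?s + (U_sum (Suc n) ?s - U_sum i ?s)) \<le> v)"
    by (rule shift2)
  finally show ?thesis unfolding survives_iff fst_conv snd_conv T1 by simp
qed

lemma (in prob_space) joint_cdf_eq_survival_prob:
  assumes indep: "indep_vars (\<lambda>_. borel) (\<lambda>k \<omega>. (Us k \<omega>, Vs k \<omega>)) {1..}"
    and distr: "\<And>k. k \<ge> 1 \<Longrightarrow> distr M borel (\<lambda>\<omega>. (Us k \<omega>, Vs k \<omega>)) = D"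
    and law_D: "increment_law D"
  shows "joint_cdf M Us Vs = survival_prob D"
proof
  have D: "sets D = sets borel" by (rule increment_law.sets_D[OF law_D])
  let ?F = "\<lambda>\<omega>. to_stream (\<lambda>k. (Us (Suc k) \<omega>, Vs (Suc k) \<omega>))"
  have indep': "indep_vars (\<lambda>_. borel) (\<lambda>k \<omega>. (Us (Suc k) \<omega>, Vs (Suc k) \<omega>)) UNIV"
    using indep_vars_reindex_Suc[OF indep] .
  have meas[measurable]: "(\<lambda>\<omega>. (Us (Suc k) \<omega>, Vs (Suc k) \<omega>)) \<in> borel_measurable M" for k
    using indep' by (auto simp: indep_vars_def)
  have F[measurable]: "?F \<in> M \<rightarrow>\<^sub>M stream_space D"
    by (rule measurable_stream_space2) (simp add: to_stream_def measurable_cong_sets[OF refl D] meas)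
  have law: "distr M (stream_space D) ?F = stream_space D"
    by (rule distr_iid_to_stream[OF indep']) (use distr D in auto)
  fix p :: "ereal \<times> ereal"
  obtain u v where uv: "p = (u, v)" by (cases p)
  have "survival_prob D p = measure (distr M (stream_space D) ?F) {s \<in> space (stream_space D). survives p s}"
    by (simp only: law survival_prob_def)
  also have "\<dots> = prob (?F -` {s \<in> space (stream_space D). survives p s} \<inter> space M)"
    by (rule measure_distr[OF F]) (use increment_law.measurable_survives'[OF law_D, of p] in \<open>simp add: pred_def\<close>)
  also have "?F -` {s \<in> space (stream_space D). survives p s} \<inter> space M =
      {\<omega> \<in> space M. T1 Us 1 \<omega> \<le> u \<and> T2 Us Vs 1 \<omega> \<le> v}"
    using measurable_space[OF F] unfolding uv T1_T2_le_iff_survives by auto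
  finally show "joint_cdf M Us Vs p = survival_prob D p" by (simp add: joint_cdf_def uv)
qed

section \<open>The integral equation\<close>

text \<open>
  The limits are taken over punctured neighbourhoods, but the chain may sit exactly at \<open>(\<infinity>, \<infinity>)\<close>,
  for instance if it starts there.  The prescribed value at the point turns the bounds into bounds on
  full neighbourhoods.
\<close>

lemma eventually_nhds_from_Limsup:
  fixes f :: "'a::topological_space \<Rightarrow> real"
  assumes "Limsup (at x) (\<lambda>p. ereal (f p)) = ereal l" "f x = l" "e > 0"
  shows "\<forall>\<^sub>F p in nhds x. f p \<le> l + e"
proof -
  have "\<forall>\<^sub>F p in at x. ereal (f p) < ereal (l + e)"
    using assms by (intro Limsup_lessD) simp
  then have "\<forall>\<^sub>F p in at x. f p \<le> l + e" by (rule eventually_mono) simp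
  then show ?thesis using assms unfolding eventually_nhds_conv_at by simp
qed

lemma eventually_nhds_from_Liminf:
  fixes f :: "'a::topological_space \<Rightarrow> real"
  assumes "Liminf (at x) (\<lambda>p. ereal (f p)) = ereal l" "f x = l" "e > 0"
  shows "\<forall>\<^sub>F p in nhds x. l - e \<le> f p"
proof -
  have "\<forall>\<^sub>F p in at x. ereal (l - e) < ereal (f p)"
    using assms by (intro less_LiminfD) simp
  then have "\<forall>\<^sub>F p in at x. l - e \<le> f p" by (rule eventually_mono) simp
  then show ?thesis using assms unfolding eventually_nhds_conv_at by simp
qed

lemma step_integrand_eq:
  "indicator {\<omega>. ereal (U \<omega>) \<le> u} \<omega> *
       \<phi> (min (u - ereal (U \<omega>)) (v - ereal (V \<omega>)), v - ereal (V \<omega>))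
   = (if ereal (U \<omega>) \<le> u then \<phi> (tandem_step (u, v) (U \<omega>, V \<omega>)) else (0::real))"
  by (simp add: tandem_step_def)

locale tandem_increments = prob_space M for M :: "'a measure" +
  fixes U V :: "'a \<Rightarrow> real"
  assumes U[measurable]: "U \<in> borel_measurable M" and V[measurable]: "V \<in> borel_measurable M"
    and pos_part_U: "integrable M (\<lambda>\<omega>. max (U \<omega>) 0)"
    and pos_part_V: "integrable M (\<lambda>\<omega>. max (V \<omega>) 0)"
    and mean_U: "ext_expectation M U < 0" and mean_V: "ext_expectation M V < 0"
begin

definition joint_law :: "(real \<times> real) measure" where
  "joint_law = distr M borel (\<lambda>\<omega>. (U \<omega>, V \<omega>))"

lemma measurable_UV[measurable]: "(\<lambda>\<omega>. (U \<omega>, V \<omega>)) \<in> borel_measurable M"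
  by (intro borel_measurable_Pair U V)

sublocale drift: negative_drift joint_law
proof -
  interpret joint_law: prob_space joint_law unfolding joint_law_def by (rule prob_space_distr) measurable
  show "negative_drift joint_law"
  proof
    show "sets joint_law = sets borel" by (simp add: joint_law_def)
    show "integrable joint_law (\<lambda>x. max (fst x) 0)" "integrable joint_law (\<lambda>x. max (snd x) 0)"
      using pos_part_U pos_part_V unfolding joint_law_def by (simp_all add: integrable_distr_eq)
    show "ext_expectation joint_law fst < 0" "ext_expectation joint_law snd < 0"
      using mean_U mean_V unfolding joint_law_def ext_expectation_def by (simp_all add: nn_integral_distr)
  qed
qed

lemma measurable_step_integrand:
  assumes [measurable]: "\<phi> \<in> borel_measurable borel"
  shows "(\<lambda>\<omega>. if ereal (U \<omega>) \<le> u then \<phi> (tandem_step (u, v) (U \<omega>, V \<omega>)) else (0::real)) \<in> borel_measurable M"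
  unfolding tandem_step_def fst_conv snd_conv by measurable

lemma nn_integral_step:
  assumes [measurable]: "\<phi> \<in> borel_measurable borel"
  shows "(\<integral>\<^sup>+\<omega>. ennreal (if ereal (U \<omega>) \<le> u then \<phi> (tandem_step (u, v) (U \<omega>, V \<omega>)) else 0) \<partial>M)
    = transition joint_law (\<lambda>p. ennreal (\<phi> p)) (u, v)"
proof -
  have "(\<lambda>x. if ereal (fst x) \<le> fst (u, v) then ennreal (\<phi> (tandem_step (u, v) x)) else 0) \<in> borel_measurable joint_law"
    by measurable
  then show ?thesis
    unfolding transition_def joint_law_def by (subst nn_integral_distr) (auto intro!: nn_integral_cong)
qed

text \<open>
  Dropping the negative part turns the step expectation into the transition operator applied to
  the positive part.  This direction suffices for subsolutions.
\<close>

lemma step_expectation_le_transition: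
  assumes "\<phi> \<in> borel_measurable borel"
  shows "step_expectation M U V \<phi> u v \<le> enn2ereal (transition joint_law (\<lambda>p. ennreal (\<phi> p)) (u, v))"
  unfolding step_expectation_def step_integrand_eq ext_expectation_def nn_integral_step[OF assms]
  by (rule ereal_diff_le_self) simp

lemma step_expectation_eq_transition:
  assumes "\<phi> \<in> borel_measurable borel" "\<And>p. 0 \<le> \<phi> p"
  shows "step_expectation M U V \<phi> u v = enn2ereal (transition joint_law (\<lambda>p. ennreal (\<phi> p)) (u, v))"
  unfolding step_expectation_def step_integrand_eq
  using assms by (subst ext_expectation_nonneg) (auto simp: nn_integral_step)

lemma integrable_step:
  assumes "\<phi> \<in> borel_measurable borel" "bounded (range \<phi>)"
  shows "integrable M (\<lambda>\<omega>. if ereal (U \<omega>) \<le> u then \<phi> (tandem_step (u, v) (U \<omega>, V \<omega>)) else (0::real))"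
proof -
  obtain B where "\<And>p. \<bar>\<phi> p\<bar> \<le> B" using assms(2) by (auto simp: bounded_iff)
  moreover from this[of "(0, 0)"] have "0 \<le> B" by linarith
  ultimately show ?thesis
    using measurable_step_integrand[OF assms(1)] by (intro integrable_const_bound[where B=B]) auto
qed

lemma step_expectation_eq_integral:
  assumes "\<phi> \<in> borel_measurable borel" "bounded (range \<phi>)"
  shows "step_expectation M U V \<phi> u v =
    ereal (\<integral>\<omega>. (if ereal (U \<omega>) \<le> u then \<phi> (tandem_step (u, v) (U \<omega>, V \<omega>)) else 0) \<partial>M)"
  unfolding step_expectation_def step_integrand_eq
  by (rule ext_expectation_eq_integral[OF integrable_step[OF assms]])

lemma subsolution_le:
  assumes \<gamma>: "\<gamma> \<in> borel_measurable borel" "\<And>p. \<gamma> p \<le> K"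
    and sub: "\<And>u v. 0 < \<gamma> (u, v) \<Longrightarrow> ereal (\<gamma> (u, v)) \<le> step_expectation M U V \<gamma> u v"
    and lim: "\<And>e. e > 0 \<Longrightarrow> \<forall>\<^sub>F p in nhds (\<infinity>, \<infinity>). \<gamma> p \<le> 1 + e"
  shows "\<gamma> p \<le> survival_prob joint_law p"
proof (rule drift.subsolution_le_survival_prob[OF \<gamma>])
  fix p assume p: "0 < \<gamma> p"
  obtain u v where uv: "p = (u, v)" by (cases p)
  have "ereal (\<gamma> p) \<le> enn2ereal (transition joint_law (\<lambda>p. ennreal (\<gamma> p)) p)"
    using sub[of u v] step_expectation_le_transition[OF \<gamma>(1), of u v] p uv by auto
  then show "ennreal (\<gamma> p) \<le> transition joint_law (\<lambda>p. ennreal (\<gamma> p)) p"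
    using p by (simp add: less_eq_ennreal.rep_eq enn2ereal_ennreal)
qed (rule lim)

lemma le_supersolution:
  assumes \<eta>: "\<eta> \<in> borel_measurable borel" "\<And>p. 0 \<le> \<eta> p"
    and super: "\<And>u v. survival_prob joint_law (u, v) \<noteq> 0 \<Longrightarrow> u \<le> v \<Longrightarrow>
      step_expectation M U V \<eta> u v \<le> ereal (\<eta> (u, v))"
    and lim: "\<And>e. e > 0 \<Longrightarrow> \<forall>\<^sub>F p in nhds (\<infinity>, \<infinity>). 1 - e \<le> \<eta> p"
    and p: "fst p \<le> snd p"
  shows "survival_prob joint_law p \<le> \<eta> p"
proof (rule drift.survival_prob_le_supersolution[OF \<eta> _ _ p])
  fix p assume p: "survival_prob joint_law p \<noteq> 0" "fst p \<le> snd p"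
  obtain u v where uv: "p = (u, v)" by (cases p)
  have "enn2ereal (transition joint_law (\<lambda>p. ennreal (\<eta> p)) p) \<le> ereal (\<eta> p)"
    using super[of u v] step_expectation_eq_transition[OF \<eta>, of u v] p uv by auto
  then show "transition joint_law (\<lambda>p. ennreal (\<eta> p)) p \<le> ennreal (\<eta> p)"
    using \<eta>(2) by (simp add: less_eq_ennreal.rep_eq enn2ereal_ennreal)
qed (rule lim)

lemma is_solution_survival_prob: "is_solution M U V (survival_prob joint_law)"
  unfolding is_solution_def
proof (intro conjI allI)
  show "survival_prob joint_law \<in> borel_measurable borel" by measurable
  show "bounded (range (survival_prob joint_law))"
    using drift.survival_prob_le_1 drift.survival_prob_nonneg by (auto simp: bounded_iff intro!: exI[of _ 1])
  have ev: "\<forall>\<^sub>F p in nhds (\<infinity>, \<infinity>). 1 - e \<le> survival_prob joint_law p" if "e > 0" for e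
    using drift.eventually_survival_prob[OF that] .
  show "(survival_prob joint_law \<longlongrightarrow> 1) (at (\<infinity>, \<infinity>))"
  proof (rule tendstoI)
    fix e :: real assume "0 < e"
    then have "\<forall>\<^sub>F p in at (\<infinity>, \<infinity>). 1 - e / 2 \<le> survival_prob joint_law p"
      using ev[of "e / 2"] by (simp add: eventually_nhds_conv_at)
    then show "\<forall>\<^sub>F p in at (\<infinity>, \<infinity>). dist (survival_prob joint_law p) 1 < e"
    proof eventually_elim
      case (elim p)
      then show ?case using \<open>0 < e\<close> drift.survival_prob_le_1[of p] by (simp add: dist_real_def)
    qed
  qed
  have "1 \<le> survival_prob joint_law (\<infinity>, \<infinity>) + e" if "e > 0" for e
    using eventually_nhds_x_imp_x[OF ev[OF that]] by simp
  then have "1 \<le> survival_prob joint_law (\<infinity>, \<infinity>)" by (rule field_le_epsilon)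
  then show "survival_prob joint_law (\<infinity>, \<infinity>) = 1"
    using drift.survival_prob_le_1[of "(\<infinity>, \<infinity>)"] by simp
  show "step_expectation M U V (survival_prob joint_law) u v = ereal (survival_prob joint_law (u, v))" for u v
    by (simp add: step_expectation_eq_transition drift.survival_prob_nonneg drift.transition_survival_prob enn2ereal_ennreal)
qed

lemma solution_le_survival_prob:
  assumes "is_solution M U V \<phi>"
  shows "\<phi> p \<le> survival_prob joint_law p"
proof -
  note sol = assms[unfolded is_solution_def]
  obtain K where K: "\<And>p. \<bar>\<phi> p\<bar> \<le> K" using sol by (auto simp: bounded_iff)
  have "\<forall>\<^sub>F p in nhds (\<infinity>, \<infinity>). \<phi> p \<le> 1 + e" if "e > 0" for e
  proof -
    have "\<forall>\<^sub>F p in at (\<infinity>, \<infinity>). \<phi> p < 1 + e"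
      using sol that by (intro order_tendstoD(2)[of \<phi> 1]) auto
    then have "\<forall>\<^sub>F p in at (\<infinity>, \<infinity>). \<phi> p \<le> 1 + e" by (rule eventually_mono) simp
    then show ?thesis using sol that by (simp add: eventually_nhds_conv_at)
  qed
  then show ?thesis
    using sol K by (intro subsolution_le[where K=K]) (auto simp: abs_le_iff)
qed

text \<open>
  The reflection \<open>2 * \<psi> - \<phi>\<close> of a solution \<open>\<phi>\<close> at \<open>\<psi>\<close> is again a solution, because the integrals
  are linear on bounded functions.  The upper bound for solutions, applied to both, gives equality.
\<close>

lemma solution_eq_survival_prob:
  assumes "is_solution M U V \<phi>"
  shows "\<phi> = survival_prob joint_law"
proof -
  let ?\<psi> = "survival_prob joint_law"
  define \<gamma> where "\<gamma> p = 2 * ?\<psi> p - \<phi> p" for p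
  note \<phi> = assms[unfolded is_solution_def]
  note \<psi> = is_solution_survival_prob[unfolded is_solution_def]
  have meas: "\<gamma> \<in> borel_measurable borel" unfolding \<gamma>_def using \<phi> \<psi> by auto
  have bdd: "bounded (range \<gamma>)"
  proof -
    obtain B C where "\<And>p. \<bar>\<phi> p\<bar> \<le> B" "\<And>p. \<bar>?\<psi> p\<bar> \<le> C" using \<phi> \<psi> by (auto simp: bounded_iff)
    then have bounds: "\<bar>\<phi> p\<bar> \<le> B \<and> \<bar>?\<psi> p\<bar> \<le> C" for p by blast
    have "\<bar>\<gamma> p\<bar> \<le> 2 * C + B" for p
      using bounds[of p] unfolding \<gamma>_def by linarith
    then show ?thesis by (auto simp: bounded_iff)
  qed
  have "is_solution M U V \<gamma>"
    unfolding is_solution_def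
  proof (intro conjI allI meas bdd)
    have "((\<lambda>p. 2 * ?\<psi> p - \<phi> p) \<longlongrightarrow> 2 * 1 - 1) (at (\<infinity>, \<infinity>))"
      using \<phi> \<psi> by (intro tendsto_intros) auto
    then show "(\<gamma> \<longlongrightarrow> 1) (at (\<infinity>, \<infinity>))" by (simp add: \<gamma>_def[abs_def])
    show "\<gamma> (\<infinity>, \<infinity>) = 1" using \<phi> \<psi> by (simp add: \<gamma>_def)
    fix u v
    let ?X = "\<lambda>\<phi> \<omega>. if ereal (U \<omega>) \<le> u then \<phi> (tandem_step (u, v) (U \<omega>, V \<omega>)) else (0::real)"
    have solves: "integral\<^sup>L M (?X f) = f (u, v)" if "is_solution M U V f" for f
      using that step_expectation_eq_integral[of f u v] unfolding is_solution_def by simp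
    have "integral\<^sup>L M (?X \<gamma>) = (\<integral>\<omega>. 2 * ?X ?\<psi> \<omega> - ?X \<phi> \<omega> \<partial>M)"
      by (intro Bochner_Integration.integral_cong) (auto simp: \<gamma>_def)
    also have "\<dots> = 2 * integral\<^sup>L M (?X ?\<psi>) - integral\<^sup>L M (?X \<phi>)"
      using \<phi> \<psi> by (subst Bochner_Integration.integral_diff) (auto intro!: integrable_step)
    also have "\<dots> = \<gamma> (u, v)"
      using solves[OF assms] solves[OF is_solution_survival_prob] by (simp add: \<gamma>_def)
    finally show "step_expectation M U V \<gamma> u v = ereal (\<gamma> (u, v))"
      by (simp add: step_expectation_eq_integral meas bdd)
  qed
  then have "\<phi> p = ?\<psi> p" for p
    using solution_le_survival_prob[of \<gamma> p] solution_le_survival_prob[OF assms, of p]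
    by (simp add: \<gamma>_def)
  then show ?thesis by blast
qed

end

theorem theorem1:
  fixes M :: "'a measure" and U V :: "'a \<Rightarrow> real" and Us Vs :: "nat \<Rightarrow> 'a \<Rightarrow> real"
  assumes "prob_space M"
    and "U \<in> borel_measurable M" and "V \<in> borel_measurable M"
    and "measure M {\<omega> \<in> space M. U \<omega> > 0} > 0" and "measure M {\<omega> \<in> space M. V \<omega> > 0} > 0"
    and "integrable M (\<lambda>\<omega>. max (U \<omega>) 0)" and "integrable M (\<lambda>\<omega>. max (V \<omega>) 0)"
    and "ext_expectation M U < 0" and "ext_expectation M V < 0"
    and "prob_space.indep_vars M (\<lambda>_. borel) (\<lambda>k \<omega>. (Us k \<omega>, Vs k \<omega>)) {1..}"
    and "\<And>k. k \<ge> 1 \<Longrightarrow>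
           distr M borel (\<lambda>\<omega>. (Us k \<omega>, Vs k \<omega>)) = distr M borel (\<lambda>\<omega>. (U \<omega>, V \<omega>))"
  shows "((\<exists>!\<phi>. is_solution M U V \<phi>) \<and> is_solution M U V (joint_cdf M Us Vs)) \<and>
    (\<forall>\<gamma> :: ereal \<times> ereal \<Rightarrow> real.
       \<gamma> \<in> borel_measurable borel \<longrightarrow> (\<exists>K. \<forall>p. \<gamma> p \<le> K) \<longrightarrow>
       (\<forall>u v. (u, v) \<in> supp (\<lambda>p. max (\<gamma> p) 0) \<longrightarrow>
          step_expectation M U V \<gamma> u v \<ge> ereal (\<gamma> (u, v))) \<longrightarrow>
       Limsup (at (\<infinity>, \<infinity>)) (\<lambda>p. ereal (\<gamma> p)) = 1 \<longrightarrow> \<gamma> (\<infinity>, \<infinity>) = 1 \<longrightarrow>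
       (\<forall>u v. joint_cdf M Us Vs (u, v) \<ge> \<gamma> (u, v))) \<and>
    (\<forall>\<eta> :: ereal \<times> ereal \<Rightarrow> real.
       \<eta> \<in> borel_measurable borel \<longrightarrow> (\<forall>p. 0 \<le> \<eta> p) \<longrightarrow>
       (\<forall>u v. (u, v) \<in> supp (joint_cdf M Us Vs) \<longrightarrow> v \<ge> u \<longrightarrow>
          step_expectation M U V \<eta> u v \<le> ereal (\<eta> (u, v))) \<longrightarrow>
       Liminf (at (\<infinity>, \<infinity>)) (\<lambda>p. ereal (\<eta> p)) = 1 \<longrightarrow> \<eta> (\<infinity>, \<infinity>) = 1 \<longrightarrow>
       (\<forall>u v. v \<ge> u \<longrightarrow> joint_cdf M Us Vs (u, v) \<le> \<eta> (u, v)))"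
proof -
  interpret tandem_increments M U V
    using assms by (simp add: tandem_increments_def tandem_increments_axioms_def)
  have cdf: "joint_cdf M Us Vs = survival_prob joint_law"
    by (rule joint_cdf_eq_survival_prob[OF assms(10) _ drift.increment_law_axioms])
      (simp add: assms(11) joint_law_def)
  show ?thesis
    unfolding cdf
  proof (intro conjI allI impI)
    show "\<exists>!\<phi>. is_solution M U V \<phi>"
      using is_solution_survival_prob solution_eq_survival_prob by blast
    show "is_solution M U V (survival_prob joint_law)" by (rule is_solution_survival_prob)
  next
    fix \<gamma> :: "ereal \<times> ereal \<Rightarrow> real" and u v
    assume \<gamma>: "\<gamma> \<in> borel_measurable borel" and "\<exists>K. \<forall>p. \<gamma> p \<le> K"
      and sub: "\<forall>u v. (u, v) \<in> supp (\<lambda>p. max (\<gamma> p) 0) \<longrightarrow>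
        ereal (\<gamma> (u, v)) \<le> step_expectation M U V \<gamma> u v"
      and lim: "Limsup (at (\<infinity>, \<infinity>)) (\<lambda>p. ereal (\<gamma> p)) = 1" "\<gamma> (\<infinity>, \<infinity>) = 1"
    then obtain K where K: "\<And>p. \<gamma> p \<le> K" by blast
    show "\<gamma> (u, v) \<le> survival_prob joint_law (u, v)"
    proof (rule subsolution_le[OF \<gamma> K])
      show "ereal (\<gamma> (u, v)) \<le> step_expectation M U V \<gamma> u v" if "0 < \<gamma> (u, v)" for u v
        using sub that by (simp add: supp_def)
      show "\<forall>\<^sub>F p in nhds (\<infinity>, \<infinity>). \<gamma> p \<le> 1 + e" if "e > 0" for e
        using eventually_nhds_from_Limsup[OF lim(1)[unfolded one_ereal_def] lim(2) that] .
    qed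
  next
    fix \<eta> :: "ereal \<times> ereal \<Rightarrow> real" and u v :: ereal
    assume \<eta>: "\<eta> \<in> borel_measurable borel" and nonneg: "\<forall>p. 0 \<le> \<eta> p"
      and super: "\<forall>u v. (u, v) \<in> supp (survival_prob joint_law) \<longrightarrow> u \<le> v \<longrightarrow>
        step_expectation M U V \<eta> u v \<le> ereal (\<eta> (u, v))"
      and lim: "Liminf (at (\<infinity>, \<infinity>)) (\<lambda>p. ereal (\<eta> p)) = 1" "\<eta> (\<infinity>, \<infinity>) = 1"
      and uv: "u \<le> v"
    show "survival_prob joint_law (u, v) \<le> \<eta> (u, v)"
    proof (rule le_supersolution[OF \<eta> nonneg[rule_format]])
      show "step_expectation M U V \<eta> u v \<le> ereal (\<eta> (u, v))"
        if "survival_prob joint_law (u, v) \<noteq> 0" "u \<le> v" for u v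
        using super that by (simp add: supp_def)
      show "\<forall>\<^sub>F p in nhds (\<infinity>, \<infinity>). 1 - e \<le> \<eta> p" if "e > 0" for e
        using eventually_nhds_from_Liminf[OF lim(1)[unfolded one_ereal_def] lim(2) that] .
    qed (simp add: uv)
  qed
qed

end
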